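(* Let $p>3$ be a prime and $r$ a positive integer. Then $$\sum_{k=0}^{\frac{p^r-1}{2}} (4k+1) \left(\frac{(\frac12)_k}{k!}\right)^4\equiv p^r \pmod{p^{3+r}}.$$
   Context: For $a\in\mathbb{C}$ and $k\in\mathbb{N}$, $(a)_k=a(a+1)\cdots(a+k-1)$ denotes the rising factorial, with $(a)_0=1$. A congruence $A\equiv B \pmod{p^m}$ between rational numbers means that $A-B\in p^m\mathbb{Z}_{(p)}$ (i.e. $A-B$ is $p^m$ times a rational number whose denominator is prime to $p$). *)

theory Defs
  imports Complex_Main "HOL-Computational_Algebra.Primes"
begin

definition localized_ints :: "nat \<Rightarrow> rat set" where
  "localized_ints p = {x. coprime (snd (quotient_of x)) (int p)}"

definition rat_cong :: "rat \<Rightarrow> rat \<Rightarrow> nat \<Rightarrow> nat \<Rightarrow> bool" where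
  "rat_cong A B p m \<longleftrightarrow> (\<exists>x \<in> localized_ints p. A - B = of_nat (p ^ m) * x)"

end

theory Submission
  imports Defs
begin

text \<open>Write \<open>n = p\<^sup>r = 2 N + 1\<close> and \<open>A\<^sub>k = (1/2)\<^sub>k / k!\<close>. Whipple's transformation, truncated at \<open>N\<close>,
  turns \<open>\<Sum>\<^sub>k (4 k + 1) A\<^sub>k\<^sup>2 (1/2 + x)\<^sub>k (1/2 - x)\<^sub>k / ((1 - x)\<^sub>k (1 + x)\<^sub>k)\<close> into
  \<open>n A\<^sub>N\<^sup>2 \<Sum>\<^sub>j c\<^sub>j n / (2 j + 1) / \<Prod>\<^sub>i\<^sub>\<le>\<^sub>j (1 - x\<^sup>2 / i\<^sup>2)\<close>,
  where the \<open>c\<^sub>j\<close> are \<open>p\<close>-integral and independent of \<open>x\<close>. For \<open>x = 0\<close> this is the sum in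
  question; for \<open>x = n / 2\<close> the series terminates and Dougall's summation evaluates it to exactly
  \<open>n\<close>. The two values differ by \<open>n A\<^sub>N\<^sup>2\<close> times a \<open>p\<close>-integral combination of the numbers
  \<open>n / (2 j + 1) (1 - 1 / \<Prod>\<^sub>i\<^sub>\<le>\<^sub>j (1 - (n / (2 i))\<^sup>2))\<close>. Every \<open>n / (2 i)\<close> is divisible by \<open>p\<close>, and
  so is \<open>n / (2 j + 1)\<close> unless \<open>j = N\<close>; for \<open>j = N\<close> the third factor of \<open>p\<close> comes from the sum of
  the \<open>(n / i)\<^sup>2\<close>, which is where \<open>p > 3\<close> enters.\<close>

section \<open>The Pfaff--Saalschuetz summation\<close>

lemma binomial_mult_pochhammer_Suc_Suc:
  fixes c :: "'a :: comm_ring_1"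
  assumes "k \<le> N"
  shows "of_nat (Suc N choose Suc k) * pochhammer (c + of_nat (Suc k)) (N - k)
     = (c + of_nat N + of_nat (Suc k)) * of_nat (N choose Suc k)
         * pochhammer (c + of_nat (Suc k)) (N - Suc k)
       + of_nat (N choose k) * pochhammer (c + of_nat k) (N - k)"
proof (cases "k = N")
  case False
  with assms obtain d where N_eq: "N = Suc (k + d)"
    using less_iff_Suc_add le_neq_implies_less by metis
  define X where "X = pochhammer (c + of_nat (Suc k)) d"
  have "Suc k * (N choose Suc k) = Suc d * (N choose k)"
    using Suc_times_binomial_add[of k d] by (simp only: N_eq)
  then have "of_nat (Suc k) * of_nat (N choose Suc k) = (of_nat (Suc d) * of_nat (N choose k) :: 'a)"
    by (metis of_nat_mult)
  then have "of_nat (Suc N choose Suc k) * (c + of_nat N)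
      = (c + of_nat N + of_nat (Suc k)) * of_nat (N choose Suc k)
        + of_nat (N choose k) * (c + of_nat k)"
    by (simp add: N_eq algebra_simps)
  then have "of_nat (Suc N choose Suc k) * (c + of_nat N) * X
      = (c + of_nat N + of_nat (Suc k)) * of_nat (N choose Suc k) * X
        + of_nat (N choose k) * ((c + of_nat k) * X)"
    by (simp only: distrib_right mult.assoc)
  moreover have "pochhammer (c + of_nat (Suc k)) (N - k) = (c + of_nat N) * X"
    by (simp add: X_def N_eq pochhammer_rec' algebra_simps)
  moreover have "pochhammer (c + of_nat k) (N - k) = (c + of_nat k) * X"
    by (simp add: X_def N_eq pochhammer_rec algebra_simps)
  ultimately show ?thesis
    by (simp add: X_def N_eq mult.assoc del: binomial_Suc_Suc of_nat_Suc)
qed (simp add: binomial_eq_0)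

theorem pfaff_saalschuetz:
  fixes a b c :: "'a :: comm_ring_1"
  shows "(\<Sum>k\<le>N. of_nat (N choose k) * pochhammer (c + of_nat k) (N - k)
            * (pochhammer a k * pochhammer b k * pochhammer (c - a - b) (N - k)))
         = pochhammer (c - a) N * pochhammer (c - b) N"
proof (induction N)
  case (Suc N)
  define w where "w = (\<lambda>k. of_nat (N choose k) * pochhammer (c + of_nat k) (N - k))"
  define f where "f = (\<lambda>M k. pochhammer a k * pochhammer b k * pochhammer (c - a - b) (M - k))"
  have w_Suc: "of_nat (Suc N choose Suc k) * pochhammer (c + of_nat (Suc k)) (N - k)
      = (c + of_nat N + of_nat (Suc k)) * w (Suc k) + w k" if "k \<le> N" for k
    using binomial_mult_pochhammer_Suc_Suc[OF that, of c] by (simp only: w_def mult.assoc)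
  have w_0: "pochhammer c N = w 0" and w_beyond: "w (Suc N) = 0"
    by (simp_all add: w_def binomial_eq_0)
  have f_Suc: "(c + of_nat N + of_nat k) * f (Suc N) k + f (Suc N) (Suc k)
      = (c - a + of_nat N) * (c - b + of_nat N) * f N k" if "k \<le> N" for k
  proof -
    have "(c + of_nat N + of_nat k) * f (Suc N) k + f (Suc N) (Suc k)
        = f N k * ((c + of_nat N + of_nat k) * (c - a - b + of_nat (N - k))
            + (a + of_nat k) * (b + of_nat k))"
      using that by (simp add: f_def Suc_diff_le pochhammer_Suc algebra_simps)
    also have "(c + of_nat N + of_nat k) * (c - a - b + of_nat (N - k)) + (a + of_nat k) * (b + of_nat k)
        = (c - a + of_nat N) * (c - b + of_nat N)"
      using that by (simp add: of_nat_diff algebra_simps)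
    finally show ?thesis by (simp add: mult_ac)
  qed
  have "(\<Sum>k\<le>Suc N. of_nat (Suc N choose k) * pochhammer (c + of_nat k) (Suc N - k) * f (Suc N) k)
      = (c + of_nat N) * w 0 * f (Suc N) 0
        + (\<Sum>k\<le>N. ((c + of_nat N + of_nat (Suc k)) * w (Suc k) + w k) * f (Suc N) (Suc k))"
    by (simp add: sum.atMost_Suc_shift w_Suc w_0 pochhammer_rec'
        del: sum.atMost_Suc binomial_Suc_Suc of_nat_Suc flip: One_nat_def)
  also have "\<dots> = (\<Sum>k\<le>Suc N. (c + of_nat N + of_nat k) * w k * f (Suc N) k)
      + (\<Sum>k\<le>N. w k * f (Suc N) (Suc k))"
    by (simp add: sum.atMost_Suc_shift distrib_right sum.distrib add.assoc del: of_nat_Suc sum.atMost_Suc)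
  also have "\<dots> = (\<Sum>k\<le>N. w k * ((c + of_nat N + of_nat k) * f (Suc N) k + f (Suc N) (Suc k)))"
    by (simp add: w_beyond sum.distrib algebra_simps del: of_nat_Suc)
  also have "\<dots> = (c - a + of_nat N) * (c - b + of_nat N) * (\<Sum>k\<le>N. w k * f N k)"
    unfolding sum_distrib_left by (intro sum.cong refl) (simp add: f_Suc mult.left_commute)
  also have "(\<Sum>k\<le>N. w k * f N k) = pochhammer (c - a) N * pochhammer (c - b) N"
    using Suc.IH by (simp add: w_def f_def)
  finally show ?case
    by (simp add: f_def pochhammer_rec' mult_ac)
qed simp

section \<open>Truncated very-well-poised sums\<close>

definition well_poised_ratio :: "'a :: field \<Rightarrow> 'a \<Rightarrow> nat \<Rightarrow> 'a" where
  "well_poised_ratio a b k = pochhammer b k / pochhammer (1 + a - b) k"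

lemma well_poised_ratio_self: "well_poised_ratio a a k = pochhammer a k / fact k"
  by (simp add: well_poised_ratio_def pochhammer_fact)

definition very_well_poised_weight :: "'a :: field \<Rightarrow> 'a \<Rightarrow> nat \<Rightarrow> 'a" where
  "very_well_poised_weight a d k
     = (a + 2 * of_nat k) * well_poised_ratio a a k * well_poised_ratio a d k"

lemma pochhammer_reflection:
  fixes x :: "'a :: comm_ring_1"
  shows "pochhammer (1 - x - of_nat k) k = (-1) ^ k * pochhammer x k"
  using pochhammer_minus[of "x + of_nat k - 1" k] by (simp add: algebra_simps)

lemma pochhammer_divide_pochhammer_shift:
  fixes d :: "'a :: field"
  assumes "pochhammer d (Suc j) \<noteq> 0"
  shows "pochhammer d j / pochhammer (1 + d) j = d / (d + of_nat j)"
proof -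
  have "d * pochhammer (1 + d) j = pochhammer d j * (d + of_nat j)"
    using pochhammer_rec[of d j] pochhammer_Suc[of d j] by (simp add: add.commute)
  moreover have "d + of_nat j \<noteq> 0" "pochhammer (1 + d) j \<noteq> 0"
    using assms pochhammer_rec[of d j] pochhammer_Suc[of d j] by (auto simp: add.commute)
  ultimately show ?thesis
    by (simp add: frac_eq_eq)
qed

lemma well_poised_ratio_mult:
  fixes a b c :: "'a :: field_char_0"
  assumes "pochhammer (1 + a - b) k \<noteq> 0" "pochhammer (1 + a - c) k \<noteq> 0"
  shows "well_poised_ratio a b k * well_poised_ratio a c k
     = (\<Sum>j\<le>k. (-1) ^ j * pochhammer (1 + a - b - c) j
           / (pochhammer (1 + a - b) j * pochhammer (1 + a - c) j)
           * (of_nat (k choose j) * pochhammer (a + of_nat k) j))"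
    (is "_ = (\<Sum>j\<le>k. ?t j)")
proof -
  define u v where "u = 1 + a - b" and "v = 1 + a - c"
  define x y where "x = a + of_nat k" and "y = u - c"
  have poch_u: "pochhammer (u + of_nat j) (k - j) = pochhammer u k / pochhammer u j"
    and poch_v: "pochhammer (u - x - y) (k - j) = (-1) ^ k * (-1) ^ j * pochhammer v k / pochhammer v j"
    if "j \<le> k" for j
  proof -
    show "pochhammer (u + of_nat j) (k - j) = pochhammer u k / pochhammer u j"
      using pochhammer_product[OF that, of u] assms(1) by (auto simp: u_def)
    have "u - x - y = 1 - (v + of_nat j) - of_nat (k - j)"
      using that by (simp add: u_def v_def x_def y_def of_nat_diff)
    then have "pochhammer (u - x - y) (k - j) = (-1) ^ (k - j) * pochhammer (v + of_nat j) (k - j)"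
      by (simp only: pochhammer_reflection)
    also have "pochhammer (v + of_nat j) (k - j) = pochhammer v k / pochhammer v j"
      using pochhammer_product[OF that, of v] assms(2) by (auto simp: v_def)
    also have "(-1) ^ (k - j) = ((-1) ^ k * (-1) ^ j :: 'a)"
      using that by (simp add: minus_one_power_iff)
    finally show "pochhammer (u - x - y) (k - j) = (-1) ^ k * (-1) ^ j * pochhammer v k / pochhammer v j"
      by simp
  qed
  have "(-1) ^ k * pochhammer b k * pochhammer c k = pochhammer (u - x) k * pochhammer (u - y) k"
    using pochhammer_reflection[of b k] by (simp add: u_def x_def y_def algebra_simps)
  also have "\<dots> = (\<Sum>j\<le>k. of_nat (k choose j) * pochhammer (u + of_nat j) (k - j)
            * (pochhammer x j * pochhammer y j * pochhammer (u - x - y) (k - j)))"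
    by (rule pfaff_saalschuetz[symmetric])
  also have "\<dots> = (-1) ^ k * (pochhammer u k * pochhammer v k) * (\<Sum>j\<le>k. ?t j)"
    unfolding sum_distrib_left
    by (intro sum.cong refl)
       (simp add: poch_u poch_v mult_ac flip: u_def v_def x_def y_def)
  finally have "pochhammer b k * pochhammer c k = pochhammer u k * pochhammer v k * (\<Sum>j\<le>k. ?t j)"
    by (simp add: mult.assoc)
  moreover have "pochhammer u k \<noteq> 0" "pochhammer v k \<noteq> 0"
    using assms by (simp_all add: u_def v_def)
  ultimately show ?thesis
    by (simp add: well_poised_ratio_def nonzero_divide_eq_eq mult_ac flip: u_def v_def)
qed

lemma times_sum_very_well_poised_binomial:
  fixes a d :: "'a :: field_char_0"
  assumes "pochhammer (1 + a - d) N \<noteq> 0"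
  shows "(d + of_nat j) * (\<Sum>k\<le>N. very_well_poised_weight a d k
            * (of_nat (k choose j) * pochhammer (a + of_nat k) j))
     = of_nat (N choose j) * pochhammer a (Suc (N + j)) * pochhammer d (Suc N)
         / (fact N * pochhammer (1 + a - d) N)"
  using assms
proof (induction N)
  case 0
  show ?case by (cases j) (simp_all add: very_well_poised_weight_def well_poised_ratio_def)
next
  case (Suc N)
  define X where "X = pochhammer a (Suc N + j) * pochhammer d (Suc N)
      / (fact (Suc N) * pochhammer (1 + a - d) (Suc N))"
  define C where "C = (of_nat (Suc N choose j) :: 'a)"
  have neq_0: "pochhammer (1 + a - d) N \<noteq> 0" "1 + a - d + of_nat N \<noteq> 0"
    using Suc.prems by (simp_all add: pochhammer_Suc)
  have absorb: "of_nat (Suc N) * of_nat (N choose j) = (of_nat (Suc N) - of_nat j) * C"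
    using gbinomial_absorb_comp[of "of_nat (Suc N) :: 'a" j] by (simp add: C_def binomial_gbinomial)
  have "of_nat (N choose j) * pochhammer a (Suc (N + j)) * pochhammer d (Suc N)
         / (fact N * pochhammer (1 + a - d) N)
      = X * (of_nat (Suc N) * of_nat (N choose j)) * (1 + a - d + of_nat N)"
    using neq_0 by (simp add: X_def pochhammer_Suc[of "1 + a - d"] del: of_nat_Suc)
  then have previous_sum: "of_nat (N choose j) * pochhammer a (Suc (N + j)) * pochhammer d (Suc N)
         / (fact N * pochhammer (1 + a - d) N)
      = X * C * ((of_nat (Suc N) - of_nat j) * (a - d + of_nat (Suc N)))"
    unfolding absorb by (simp add: algebra_simps)
  have new_term: "very_well_poised_weight a d (Suc N)
        * (of_nat (Suc N choose j) * pochhammer (a + of_nat (Suc N)) j)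
      = (a + 2 * of_nat (Suc N)) * (X * C)"
    unfolding X_def C_def pochhammer_product'[of a "Suc N" j]
    by (simp add: very_well_poised_weight_def well_poised_ratio_def pochhammer_fact mult_ac
        del: of_nat_Suc binomial_Suc_Suc)
  have "(d + of_nat j) * (\<Sum>k\<le>Suc N. very_well_poised_weight a d k
            * (of_nat (k choose j) * pochhammer (a + of_nat k) j))
      = X * C * ((of_nat (Suc N) - of_nat j) * (a - d + of_nat (Suc N)))
        + (d + of_nat j) * ((a + 2 * of_nat (Suc N)) * (X * C))"
    unfolding sum.atMost_Suc distrib_left[of "d + of_nat j"] Suc.IH[OF neq_0(1)] previous_sum new_term ..
  also have "\<dots> = X * C * ((a + of_nat (Suc N + j)) * (d + of_nat (Suc N)))"
    by (simp add: algebra_simps)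
  also have "\<dots> = of_nat (Suc N choose j) * pochhammer a (Suc (Suc N + j)) * pochhammer d (Suc (Suc N))
         / (fact (Suc N) * pochhammer (1 + a - d) (Suc N))"
    unfolding pochhammer_Suc[of a "Suc N + j"] pochhammer_Suc[of d "Suc N"]
    by (simp add: X_def C_def mult_ac del: binomial_Suc_Suc of_nat_Suc of_nat_add)
  finally show ?case .
qed

corollary sum_very_well_poised_binomial:
  fixes a d :: "'a :: field_char_0"
  assumes "pochhammer (1 + a - d) N \<noteq> 0" "pochhammer d (Suc N) \<noteq> 0" "j \<le> N"
  shows "(\<Sum>k\<le>N. very_well_poised_weight a d k * (of_nat (k choose j) * pochhammer (a + of_nat k) j))
     = pochhammer a (Suc N) * pochhammer (1 + d) N / (fact N * pochhammer (1 + a - d) N)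
         * (of_nat (N choose j) * pochhammer (1 + a + of_nat N) j
             * (pochhammer d j / pochhammer (1 + d) j))"
    (is "?S = _")
proof -
  have pochhammer_neq_0: "pochhammer d (Suc j) \<noteq> 0"
    using pochhammer_neq_0_mono[OF assms(2), of "Suc j"] assms(3) by simp
  then have "?S = (d + of_nat j) * ?S / (d + of_nat j)"
    by (simp add: pochhammer_Suc)
  also have "(d + of_nat j) * ?S = of_nat (N choose j) * pochhammer a (Suc (N + j)) * pochhammer d (Suc N)
      / (fact N * pochhammer (1 + a - d) N)"
    by (rule times_sum_very_well_poised_binomial[OF assms(1)])
  also have "pochhammer a (Suc (N + j)) = pochhammer a (Suc N) * pochhammer (1 + a + of_nat N) j"
    using pochhammer_product'[of a "Suc N" j] by (simp add: add_ac)
  finally show ?thesis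
    by (simp add: pochhammer_divide_pochhammer_shift[OF pochhammer_neq_0] pochhammer_rec[of d N]
        add.commute mult_ac)
qed

text \<open>This is the transformation of the terminating \<open>\<^sub>7F\<^sub>6\<close> with the further parameters \<open>- N\<close> and
  \<open>1 + a + N\<close>, whose well-poised ratios are inverse to each other up to \<open>k = N\<close>.\<close>

theorem whipple_transformation_truncated:
  fixes a b c d :: "'a :: field_char_0"
  assumes "pochhammer (1 + a - b) N \<noteq> 0" "pochhammer (1 + a - c) N \<noteq> 0"
    and "pochhammer (1 + a - d) N \<noteq> 0" "pochhammer d (Suc N) \<noteq> 0"
  shows "(\<Sum>k\<le>N. very_well_poised_weight a d k
             * (well_poised_ratio a b k * well_poised_ratio a c k))
     = pochhammer a (Suc N) * pochhammer (1 + d) N / (fact N * pochhammer (1 + a - d) N)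
         * (\<Sum>j\<le>N. (-1) ^ j * of_nat (N choose j) * pochhammer (1 + a + of_nat N) j
               * (pochhammer (1 + a - b - c) j / (pochhammer (1 + a - b) j * pochhammer (1 + a - c) j))
               * (pochhammer d j / pochhammer (1 + d) j))"
proof -
  define K where "K = pochhammer a (Suc N) * pochhammer (1 + d) N / (fact N * pochhammer (1 + a - d) N)"
  define e where "e = (\<lambda>j. (-1) ^ j * pochhammer (1 + a - b - c) j
           / (pochhammer (1 + a - b) j * pochhammer (1 + a - c) j))"
  define t where "t = (\<lambda>k j. of_nat (k choose j) * pochhammer (a + of_nat k) j)"
  have expand: "well_poised_ratio a b k * well_poised_ratio a c k = (\<Sum>j\<le>N. e j * t k j)" if "k \<le> N" for k
  proof -
    have "well_poised_ratio a b k * well_poised_ratio a c k = (\<Sum>j\<le>k. e j * t k j)"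
      using well_poised_ratio_mult[of a b k c] pochhammer_neq_0_mono[OF assms(1) that]
        pochhammer_neq_0_mono[OF assms(2) that] by (simp add: e_def t_def)
    also have "\<dots> = (\<Sum>j\<le>N. e j * t k j)"
      using that by (intro sum.mono_neutral_left) (auto simp: t_def)
    finally show ?thesis .
  qed
  have "(\<Sum>k\<le>N. very_well_poised_weight a d k * (well_poised_ratio a b k * well_poised_ratio a c k))
      = (\<Sum>k\<le>N. \<Sum>j\<le>N. e j * (very_well_poised_weight a d k * t k j))"
    by (intro sum.cong refl) (simp add: expand sum_distrib_left mult_ac)
  also have "\<dots> = (\<Sum>j\<le>N. e j * (\<Sum>k\<le>N. very_well_poised_weight a d k * t k j))"
    by (subst sum.swap) (simp add: sum_distrib_left)
  also have "\<dots> = (\<Sum>j\<le>N. e j * (K * (of_nat (N choose j) * pochhammer (1 + a + of_nat N) j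
      * (pochhammer d j / pochhammer (1 + d) j))))"
    using sum_very_well_poised_binomial[OF assms(3,4)] by (simp add: t_def K_def)
  finally show ?thesis
    by (simp add: e_def sum_distrib_left mult_ac flip: K_def)
qed

theorem dougall_5F4_summation:
  fixes a b d :: "'a :: field_char_0"
  assumes "pochhammer (1 + a - b) N \<noteq> 0" "pochhammer (1 + a - d) N \<noteq> 0"
    and "pochhammer (1 + a + of_nat N) N \<noteq> 0" "pochhammer d (Suc N) \<noteq> 0"
  shows "(\<Sum>k\<le>N. very_well_poised_weight a d k
             * (well_poised_ratio a b k * well_poised_ratio a (- of_nat N) k))
     = pochhammer a (Suc N) * pochhammer (1 + a - b - d) N
         / (pochhammer (1 + a - b) N * pochhammer (1 + a - d) N)"
proof -
  define u where "u = 1 + a - b"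
  have pochhammer_neq_0: "pochhammer (1 + d) N \<noteq> 0"
    using assms(4) by (simp add: pochhammer_rec add.commute)
  have "(\<Sum>k\<le>N. very_well_poised_weight a d k
             * (well_poised_ratio a b k * well_poised_ratio a (- of_nat N) k))
     = pochhammer a (Suc N) * pochhammer (1 + d) N / (fact N * pochhammer (1 + a - d) N)
         * (\<Sum>j\<le>N. (-1) ^ j * of_nat (N choose j) * pochhammer (1 + a + of_nat N) j
               * (pochhammer (u + of_nat N) j / (pochhammer u j * pochhammer (1 + a + of_nat N) j))
               * (pochhammer d j / pochhammer (1 + d) j))"
    using whipple_transformation_truncated[of a b N "- of_nat N" d] assms by (simp add: u_def)
  also have "(\<Sum>j\<le>N. (-1) ^ j * of_nat (N choose j) * pochhammer (1 + a + of_nat N) j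
               * (pochhammer (u + of_nat N) j / (pochhammer u j * pochhammer (1 + a + of_nat N) j))
               * (pochhammer d j / pochhammer (1 + d) j))
     = (\<Sum>j\<le>N. (-1) ^ j * pochhammer d j / (pochhammer u j * pochhammer (1 + d) j)
           * (of_nat (N choose j) * pochhammer (u + of_nat N) j))"
    using pochhammer_neq_0_mono[OF assms(3)] by (intro sum.cong refl) simp
  also have "\<dots> = well_poised_ratio u 1 N * well_poised_ratio u (u - d) N"
    using well_poised_ratio_mult[of u 1 N "u - d"] assms(1) pochhammer_neq_0 by (simp flip: u_def)
  also have "\<dots> = fact N / pochhammer u N * (pochhammer (u - d) N / pochhammer (1 + d) N)"
    by (simp add: well_poised_ratio_def pochhammer_fact)
  finally show ?thesis
    using pochhammer_neq_0 by (simp add: u_def)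
qed

section \<open>Specialization of the parameters\<close>

definition half_ratio :: "nat \<Rightarrow> 'a :: field_char_0" where
  "half_ratio k = pochhammer (1 / 2) k / fact k"

lemma well_poised_ratio_half: "well_poised_ratio (1 / 2) (1 / 2) k = half_ratio k"
  by (simp only: well_poised_ratio_self half_ratio_def)

lemma pochhammer_half_integer_neq_0:
  "pochhammer (of_int m + 1 / 2 :: 'a :: field_char_0) k \<noteq> 0"
proof
  assume "pochhammer (of_int m + 1 / 2 :: 'a) k = 0"
  then obtain i where "of_int m + 1 / 2 = (- of_nat i :: 'a)"
    by (auto simp: pochhammer_eq_0_iff)
  then have "of_int (2 * m + 1 + 2 * int i) = (of_int 0 :: 'a)"
    by (simp add: field_simps eq_neg_iff_add_eq_0)
  then have "2 * m + 1 + 2 * int i = 0"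
    by (simp only: of_int_eq_iff)
  then show False
    by presburger
qed

definition sine_prod :: "'a :: field_char_0 \<Rightarrow> nat \<Rightarrow> 'a" where
  "sine_prod x j = (\<Prod>i = 1..j. 1 - (x / of_nat i)\<^sup>2)"

lemma pochhammer_one_minus_mult_one_plus:
  fixes x :: "'a :: field_char_0"
  shows "pochhammer (1 - x) j * pochhammer (1 + x) j = (fact j)\<^sup>2 * sine_prod x j"
proof (induction j)
  case (Suc j)
  have "(1 - x + of_nat j) * (1 + x + of_nat j) = (of_nat (Suc j))\<^sup>2 * (1 - (x / of_nat (Suc j))\<^sup>2)"
    by (simp add: right_diff_distrib power_divide del: of_nat_Suc)
       (simp add: power2_eq_square algebra_simps)
  then show ?case
    using Suc.IH by (simp add: sine_prod_def pochhammer_Suc power_mult_distrib mult_ac del: of_nat_Suc)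
qed (simp add: sine_prod_def)

lemma pochhammer_half_divide_three_halves:
  "pochhammer (1 / 2) j / pochhammer (3 / 2) j = 1 / (2 * of_nat j + 1 :: 'a :: field_char_0)"
  using pochhammer_divide_pochhammer_shift[of "1 / 2 :: 'a" j]
    pochhammer_half_integer_neq_0[of 0 "Suc j", where 'a = 'a]
  by (simp add: field_simps)

lemma sum_half_ratio_well_poised:
  fixes x :: "'a :: field_char_0" and N :: nat
  defines "n \<equiv> 2 * of_nat N + 1"
  assumes "pochhammer (1 - x) N \<noteq> 0" "pochhammer (1 + x) N \<noteq> 0"
  shows "(\<Sum>k\<le>N. (4 * of_nat k + 1) * (half_ratio k)\<^sup>2
             * (well_poised_ratio (1 / 2) (1 / 2 + x) k * well_poised_ratio (1 / 2) (1 / 2 - x) k))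
     = n\<^sup>2 * (half_ratio N)\<^sup>2
         * (\<Sum>j\<le>N. (-1) ^ j * of_nat (N choose j) * half_ratio j * (pochhammer (1 + n / 2) j / fact j)
               / (2 * of_nat j + 1) / sine_prod x j)"
    (is "?L = _ * ?S")
proof -
  have "?L = 2 * (\<Sum>k\<le>N. (1 / 2 + 2 * of_nat k) * half_ratio k * half_ratio k
             * (well_poised_ratio (1 / 2) (1 / 2 + x) k * well_poised_ratio (1 / 2) (1 / 2 - x) k))"
    unfolding sum_distrib_left
    by (intro sum.cong refl) (simp add: power2_eq_square algebra_simps)
  also have "\<dots> = 2 * (pochhammer (1 / 2) (Suc N) * pochhammer (3 / 2) N / (fact N)\<^sup>2)
      * (\<Sum>j\<le>N. (-1) ^ j * of_nat (N choose j) * pochhammer (1 + n / 2) j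
            * (pochhammer (1 / 2) j / (pochhammer (1 - x) j * pochhammer (1 + x) j)) / (2 * of_nat j + 1))"
  proof -
    have "pochhammer (1 / 2) (Suc N) \<noteq> (0 :: 'a)"
      using pochhammer_half_integer_neq_0[of 0 "Suc N", where 'a = 'a] by simp
    moreover have "1 + 1 / 2 - (1 / 2 + x) = 1 - x" "1 + 1 / 2 - (1 / 2 - x) = 1 + x"
      "1 + 1 / 2 - (1 / 2 + x) - (1 / 2 - x) = 1 / 2" "1 + 1 / 2 + of_nat N = 1 + n / 2"
      by (simp_all add: n_def field_simps)
    ultimately show ?thesis
      using whipple_transformation_truncated[of "1 / 2" "1 / 2 + x" N "1 / 2 - x" "1 / 2"] assms(2,3)
      by (simp add: very_well_poised_weight_def well_poised_ratio_half pochhammer_half_divide_three_halves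
          pochhammer_fact[symmetric] power2_eq_square)
  qed
  also have "2 * (pochhammer (1 / 2) (Suc N) * pochhammer (3 / 2) N / (fact N)\<^sup>2)
      = n\<^sup>2 * (half_ratio N :: 'a)\<^sup>2"
  proof -
    have "2 * pochhammer (3 / 2) N = 2 * (n * pochhammer (1 / 2) N)"
      using pochhammer_rec[of "1 / 2 :: 'a" N] pochhammer_Suc[of "1 / 2 :: 'a" N]
      by (simp add: n_def field_simps)
    moreover have "2 * pochhammer (1 / 2) (Suc N) = n * pochhammer (1 / 2) N"
      by (simp add: n_def pochhammer_Suc field_simps)
    ultimately show ?thesis
      by (simp add: half_ratio_def power_divide power2_eq_square)
  qed
  finally show ?thesis
    unfolding pochhammer_one_minus_mult_one_plus by (simp add: half_ratio_def power2_eq_square mult_ac)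
qed

lemma sum_half_ratio_well_poised_terminating:
  fixes N :: nat
  defines "n \<equiv> 2 * of_nat N + 1 :: 'a :: field_char_0"
  shows "(\<Sum>k\<le>N. (4 * of_nat k + 1) * (half_ratio k)\<^sup>2
             * (well_poised_ratio (1 / 2) (1 / 2 + n / 2) k * well_poised_ratio (1 / 2) (1 / 2 - n / 2) k)) = n"
    (is "?L = _")
proof -
  have pochhammer_half_neq_0: "pochhammer (1 / 2 :: 'a) k \<noteq> 0" for k
    using pochhammer_half_integer_neq_0[of 0 k, where 'a = 'a] by simp
  have "?L = 2 * (\<Sum>k\<le>N. (1 / 2 + 2 * of_nat k) * half_ratio k * half_ratio k
             * (well_poised_ratio (1 / 2) (1 + of_nat N) k * well_poised_ratio (1 / 2) (- of_nat N) k))"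
  proof -
    have parameters: "1 / 2 + n / 2 = 1 + of_nat N" "1 / 2 - n / 2 = - of_nat N"
      by (simp_all add: n_def field_simps)
    show ?thesis
      unfolding sum_distrib_left parameters
      by (intro sum.cong refl) (simp add: power2_eq_square algebra_simps)
  qed
  also have "\<dots> = 2 * (pochhammer (1 / 2) (Suc N) * pochhammer (- of_nat N) N
      / (pochhammer (1 / 2 - of_nat N) N * pochhammer 1 N))"
  proof -
    have "1 + 1 / 2 - (1 + of_nat N) = (1 / 2 - of_nat N :: 'a)"
      "1 + 1 / 2 - (1 + of_nat N) - 1 / 2 = (- of_nat N :: 'a)"
      by simp_all
    moreover have "pochhammer (1 / 2 - of_nat N :: 'a) N \<noteq> 0"
      "pochhammer (1 + 1 / 2 + of_nat N :: 'a) N \<noteq> 0"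
      using pochhammer_half_integer_neq_0[of "- int N" N, where 'a = 'a]
        pochhammer_half_integer_neq_0[of "int N + 1" N, where 'a = 'a] by (simp_all add: add_ac)
    ultimately show ?thesis
      using dougall_5F4_summation[of "1 / 2 :: 'a" "1 + of_nat N" N "1 / 2"] pochhammer_half_neq_0
      by (simp add: very_well_poised_weight_def well_poised_ratio_half pochhammer_fact[symmetric])
  qed
  also have "pochhammer (1 / 2 - of_nat N) N = ((-1) ^ N * pochhammer (1 / 2) N :: 'a)"
    using pochhammer_reflection[of "1 / 2 :: 'a" N] by simp
  also have "pochhammer (- of_nat N) N = ((-1) ^ N * pochhammer 1 N :: 'a)"
    using pochhammer_reflection[of "1 :: 'a" N] by simp
  also have "2 * (pochhammer (1 / 2) (Suc N) * ((-1) ^ N * pochhammer 1 N)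
      / ((-1) ^ N * pochhammer (1 / 2) N * pochhammer 1 N)) = n"
    using pochhammer_half_neq_0[of N] by (simp add: n_def pochhammer_Suc pochhammer_fact[symmetric])
  finally show ?thesis .
qed

theorem sum_half_ratio_power4_minus:
  fixes N :: nat
  defines "n \<equiv> 2 * of_nat N + 1 :: 'a :: field_char_0"
  shows "(\<Sum>k\<le>N. (4 * of_nat k + 1) * half_ratio k ^ 4) - n
     = n * (half_ratio N)\<^sup>2
         * (\<Sum>j\<le>N. (-1) ^ j * of_nat (N choose j) * half_ratio j * (pochhammer (1 + n / 2) j / fact j)
               * (n / (2 * of_nat j + 1) * (1 - 1 / sine_prod (n / 2) j)))"
proof -
  define e where "e = (\<lambda>j. (-1) ^ j * of_nat (N choose j) * half_ratio j
      * (pochhammer (1 + n / 2) j / fact j) / (2 * of_nat j + 1))"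
  have "(\<Sum>k\<le>N. (4 * of_nat k + 1) * half_ratio k ^ 4)
      = (\<Sum>k\<le>N. (4 * of_nat k + 1) * (half_ratio k)\<^sup>2
             * (well_poised_ratio (1 / 2) (1 / 2 + 0) k * well_poised_ratio (1 / 2) (1 / 2 - 0) k) :: 'a)"
    by (simp add: well_poised_ratio_half power_numeral_reduce mult_ac)
  also have "\<dots> = n\<^sup>2 * (half_ratio N)\<^sup>2 * (\<Sum>j\<le>N. e j)"
    using sum_half_ratio_well_poised[of "0 :: 'a" N]
    by (simp add: e_def n_def sine_prod_def flip: pochhammer_fact)
  finally have at_0: "(\<Sum>k\<le>N. (4 * of_nat k + 1) * half_ratio k ^ 4)
      = n\<^sup>2 * (half_ratio N)\<^sup>2 * (\<Sum>j\<le>N. e j)" .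
  have "1 - n / 2 = of_int (- int N) + 1 / 2" "1 + n / 2 = of_int (int N + 1) + 1 / 2"
    by (simp_all add: n_def field_simps)
  then have pochhammer_neq_0: "pochhammer (1 - n / 2) N \<noteq> 0" "pochhammer (1 + n / 2) N \<noteq> 0"
    by (simp_all only: pochhammer_half_integer_neq_0 not_False_eq_True)
  have at_n_half: "n\<^sup>2 * (half_ratio N)\<^sup>2 * (\<Sum>j\<le>N. e j / sine_prod (n / 2) j) = n"
    unfolding e_def
    by (rule trans[OF sum_half_ratio_well_poised[OF pochhammer_neq_0, folded n_def, symmetric]
          sum_half_ratio_well_poised_terminating[of N, where 'a = 'a, folded n_def]])
  have "(\<Sum>k\<le>N. (4 * of_nat k + 1) * half_ratio k ^ 4) - n
      = n\<^sup>2 * (half_ratio N)\<^sup>2 * ((\<Sum>j\<le>N. e j) - (\<Sum>j\<le>N. e j / sine_prod (n / 2) j))"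
    by (simp only: at_0 at_n_half right_diff_distrib)
  also have "(\<Sum>j\<le>N. e j) - (\<Sum>j\<le>N. e j / sine_prod (n / 2) j)
      = (\<Sum>j\<le>N. e j * (1 - 1 / sine_prod (n / 2) j))"
    by (simp add: right_diff_distrib sum_subtractf)
  finally show ?thesis
    by (simp add: e_def sum_distrib_left power2_eq_square mult_ac)
qed

section \<open>Congruences in the localization at p\<close>

lemma localized_ints_fraction:
  assumes "coprime b (int p)" and "b \<noteq> 0"
  shows "of_int a / of_int b \<in> localized_ints p"
proof -
  obtain c d where quotient: "quotient_of (of_int a / of_int b) = (c, d)"
    by force
  have denom: "d > 0" "coprime d c"
    using quotient_of_denom_pos[OF quotient] quotient_of_coprime[OF quotient]
    by (simp_all add: coprime_commute)
  have "(of_int (c * b) :: rat) = of_int (a * d)"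
    using quotient_of_div[OF quotient] denom(1) assms(2) by (simp add: frac_eq_eq)
  then have "c * b = a * d"
    by (simp only: of_int_eq_iff)
  then have "d dvd c * b"
    by simp
  with denom(2) have "d dvd b"
    by (simp add: coprime_dvd_mult_right_iff)
  with assms(1) have "coprime d (int p)"
    using coprime_divisors dvd_refl by blast
  with quotient show ?thesis
    by (simp add: localized_ints_def)
qed

lemma localized_intsE:
  assumes "x \<in> localized_ints p"
  obtains a b where "x = of_int a / of_int b" "coprime b (int p)" "b \<noteq> 0"
proof -
  obtain c d where quotient: "quotient_of x = (c, d)"
    by force
  with assms have "coprime d (int p)"
    by (simp add: localized_ints_def)
  with that quotient_of_div[OF quotient] quotient_of_denom_pos[OF quotient] show thesis
    by auto
qed

lemma localized_ints_of_int [simp]: "of_int a \<in> localized_ints p"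
  using localized_ints_fraction[of 1 p a] by simp

lemma localized_ints_of_nat [simp]: "of_nat a \<in> localized_ints p"
  using localized_ints_of_int[of "int a" p] by simp

lemma localized_ints_0 [simp]: "0 \<in> localized_ints p"
  using localized_ints_of_int[of 0 p] by simp

lemma localized_ints_1 [simp]: "1 \<in> localized_ints p"
  using localized_ints_of_int[of 1 p] by simp

lemma localized_ints_one_divide_of_nat:
  assumes "prime p" "\<not> p dvd q"
  shows "1 / of_nat q \<in> localized_ints p"
proof -
  have "coprime (int q) (int p)"
    using prime_imp_coprime[OF assms] by (simp add: coprime_commute)
  moreover have "q \<noteq> 0"
    using assms(2) by (metis dvd_0_right)
  ultimately show ?thesis
    using localized_ints_fraction[of "int q" p 1] by simp
qed

lemma localized_ints_one_divide_numeral: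
  assumes "prime p" "numeral k < p"
  shows "1 / numeral k \<in> localized_ints p"
  using localized_ints_one_divide_of_nat[of p "numeral k"] assms by (simp add: nat_dvd_not_less)

lemma localized_ints_add:
  assumes "x \<in> localized_ints p" "y \<in> localized_ints p"
  shows "x + y \<in> localized_ints p"
proof -
  from assms obtain a b c d where "x = of_int a / of_int b" "coprime b (int p)" "b \<noteq> 0"
    "y = of_int c / of_int d" "coprime d (int p)" "d \<noteq> 0"
    by (metis localized_intsE)
  then show ?thesis
    using localized_ints_fraction[of "b * d" p "a * d + c * b"] by (simp add: add_frac_eq)
qed

lemma localized_ints_mult:
  assumes "x \<in> localized_ints p" "y \<in> localized_ints p"
  shows "x * y \<in> localized_ints p"
proof -
  from assms obtain a b c d where "x = of_int a / of_int b" "coprime b (int p)" "b \<noteq> 0"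
    "y = of_int c / of_int d" "coprime d (int p)" "d \<noteq> 0"
    by (metis localized_intsE)
  then show ?thesis
    using localized_ints_fraction[of "b * d" p "a * c"] by simp
qed

lemma localized_ints_pochhammer:
  "x \<in> localized_ints p \<Longrightarrow> pochhammer x k \<in> localized_ints p"
  by (induction k) (simp_all add: pochhammer_Suc localized_ints_add localized_ints_mult)

lemma rat_cong_iff_diff_rat_cong_0: "rat_cong x y p m \<longleftrightarrow> rat_cong (x - y) 0 p m"
  by (simp add: rat_cong_def)

lemma rat_cong_0_iff: "rat_cong x 0 p m \<longleftrightarrow> (\<exists>u\<in>localized_ints p. x = of_nat (p ^ m) * u)"
  by (simp add: rat_cong_def)

lemma rat_cong_0_0 [simp]: "rat_cong 0 0 p m"
  by (auto simp: rat_cong_0_iff intro: bexI[of _ 0])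

lemma rat_cong_0_add:
  assumes "rat_cong x 0 p m" "rat_cong y 0 p m"
  shows "rat_cong (x + y) 0 p m"
  using assms by (metis rat_cong_0_iff distrib_left localized_ints_add)

lemma rat_cong_0_mult:
  assumes "rat_cong x 0 p l" "rat_cong y 0 p m"
  shows "rat_cong (x * y) 0 p (l + m)"
proof -
  from assms obtain u v where "u \<in> localized_ints p" "x = of_nat (p ^ l) * u"
    "v \<in> localized_ints p" "y = of_nat (p ^ m) * v"
    unfolding rat_cong_0_iff by auto
  then show ?thesis
    unfolding rat_cong_0_iff
    by (intro bexI[of _ "u * v"]) (simp_all add: power_add localized_ints_mult)
qed

lemma rat_cong_0_mult_left:
  "u \<in> localized_ints p \<Longrightarrow> rat_cong x 0 p m \<Longrightarrow> rat_cong (u * x) 0 p m"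
  using rat_cong_0_mult[of u p 0 x m] by (simp add: rat_cong_0_iff[of u])

lemma rat_cong_0_diff:
  assumes "rat_cong x 0 p m" "rat_cong y 0 p m"
  shows "rat_cong (x - y) 0 p m"
  using rat_cong_0_add[OF assms(1) rat_cong_0_mult_left[OF localized_ints_of_int[of "-1"] assms(2)]]
  by simp

lemma rat_cong_0_sum:
  "(\<And>i. i \<in> I \<Longrightarrow> rat_cong (f i) 0 p m) \<Longrightarrow> rat_cong (sum f I) 0 p m"
  by (induction I rule: infinite_finite_induct) (simp_all add: rat_cong_0_add)

lemma rat_cong_0_mono:
  assumes "rat_cong x 0 p m" "l \<le> m"
  shows "rat_cong x 0 p l"
proof -
  have "rat_cong (of_nat (p ^ (m - l)) * u * of_nat (p ^ l)) 0 p l" if "u \<in> localized_ints p" for u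
    unfolding rat_cong_0_iff using that
    by (metis localized_ints_mult localized_ints_of_nat mult.commute)
  moreover have "(of_nat (p ^ m) :: rat) = of_nat (p ^ (m - l)) * of_nat (p ^ l)"
    using assms(2) by (simp flip: power_add)
  ultimately show ?thesis
    using assms(1) unfolding rat_cong_0_iff[of x p m] by (auto simp: mult_ac)
qed

lemma rat_cong_0_imp_localized_ints: "rat_cong x 0 p m \<Longrightarrow> x \<in> localized_ints p"
  using rat_cong_0_mono[of x p m 0] by (simp add: rat_cong_0_iff)

lemma rat_cong_1_imp_one_divide_localized_ints:
  assumes "p \<noteq> 1" "rat_cong x 1 p (Suc m)"
  shows "x \<noteq> 0" "1 / x \<in> localized_ints p"
proof -
  have "rat_cong (x - 1) 0 p 1"
    using assms(2) rat_cong_0_mono[of "x - 1" p "Suc m" 1]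
    by (simp add: rat_cong_iff_diff_rat_cong_0[of x])
  then obtain y where x_eq: "y \<in> localized_ints p" "x = 1 + of_nat p * y"
    by (auto simp: rat_cong_0_iff algebra_simps)
  from x_eq(1) obtain a b where y_eq: "y = of_int a / of_int b" "coprime b (int p)" "b \<noteq> 0"
    by (rule localized_intsE)
  define c where "c = a * int p + b"
  have coprime: "coprime c (int p)"
    using y_eq(2) by (simp add: c_def coprime_iff_gcd_eq_1 gcd.commute[of _ "int p"] gcd_add_mult)
  with assms(1) have "c \<noteq> 0"
    by auto
  moreover have "x = of_int c / of_int b"
    using x_eq(2) y_eq(1,3) by (simp add: c_def field_simps)
  ultimately show "x \<noteq> 0" "1 / x \<in> localized_ints p"
    using localized_ints_fraction[OF coprime, of b] y_eq(3) by simp_all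
qed

lemma prod_one_minus_rat_cong_1:
  assumes "\<And>i. i \<in> I \<Longrightarrow> rat_cong (f i) 0 p m"
  shows "rat_cong (\<Prod>i\<in>I. 1 - f i) 1 p m"
  using assms
proof (induction I rule: infinite_finite_induct)
  case (insert i I)
  define Q where "Q = (\<Prod>i\<in>I. 1 - f i)"
  have "rat_cong (Q - 1) 0 p m" and f_cong: "rat_cong (f i) 0 p m"
    using insert by (simp_all add: Q_def flip: rat_cong_iff_diff_rat_cong_0)
  then have "rat_cong ((Q - 1) - f i * (Q - 1) - f i) 0 p m"
    by (intro rat_cong_0_diff[OF rat_cong_0_diff] rat_cong_0_mult_left
        rat_cong_0_imp_localized_ints[OF f_cong] f_cong)
  also have "(Q - 1) - f i * (Q - 1) - f i = (1 - f i) * Q - 1"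
    by (simp add: algebra_simps)
  finally show ?case
    using insert.hyps by (simp add: Q_def flip: rat_cong_iff_diff_rat_cong_0)
qed (simp_all add: rat_cong_iff_diff_rat_cong_0[of 1])

lemma prod_one_minus_rat_cong_one_minus_sum:
  assumes "\<And>i. i \<in> I \<Longrightarrow> rat_cong (f i) 0 p m"
  shows "rat_cong (\<Prod>i\<in>I. 1 - f i) (1 - (\<Sum>i\<in>I. f i)) p (2 * m)"
  using assms
proof (induction I rule: infinite_finite_induct)
  case (insert i I)
  define Q S where "Q = (\<Prod>i\<in>I. 1 - f i)" and "S = (\<Sum>i\<in>I. f i)"
  have IH: "rat_cong (Q - (1 - S)) 0 p (2 * m)"
    using insert by (simp add: Q_def S_def flip: rat_cong_iff_diff_rat_cong_0)
  have "rat_cong (Q - 1) 0 p m"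
    using prod_one_minus_rat_cong_1[of I f p m] insert.prems
    by (simp add: Q_def flip: rat_cong_iff_diff_rat_cong_0)
  then have "rat_cong (f i * (Q - 1)) 0 p (2 * m)"
    using rat_cong_0_mult[of "f i" p m "Q - 1" m] insert.prems by (simp add: mult_2)
  with IH have "rat_cong ((Q - (1 - S)) - f i * (Q - 1)) 0 p (2 * m)"
    by (rule rat_cong_0_diff)
  also have "(Q - (1 - S)) - f i * (Q - 1) = (1 - f i) * Q - (1 - (f i + S))"
    by (simp add: algebra_simps)
  finally show ?case
    using insert.hyps by (simp add: Q_def S_def flip: rat_cong_iff_diff_rat_cong_0)
qed (simp_all add: rat_cong_iff_diff_rat_cong_0[of 1])

lemma rat_cong_of_int_exists:
  assumes "x \<in> localized_ints p"
  obtains y where "rat_cong x (of_int y) p m"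
proof -
  from assms obtain a b where x_eq: "x = of_int a / of_int b" "coprime b (int p)" "b \<noteq> 0"
    by (rule localized_intsE)
  then have "gcd b (int p ^ m) = 1"
    by (simp flip: coprime_iff_gcd_eq_1)
  then obtain u v where "u * b + v * int p ^ m = 1"
    using bezout_int[of b "int p ^ m"] by metis
  then have "of_int u * of_int b + of_int v * of_nat (p ^ m) = (1 :: rat)"
    by (metis of_int_1 of_int_add of_int_mult of_int_of_nat_eq of_nat_power)
  then have "of_int a * (of_int u * of_int b + of_int v * of_nat (p ^ m)) = (of_int a :: rat)"
    by simp
  then have "x - of_int (a * u) = of_nat (p ^ m) * (of_int (a * v) / of_int b)"
    using x_eq(1,3) by (simp add: field_simps del: of_nat_power)
  then have "rat_cong x (of_int (a * u)) p m"
    unfolding rat_cong_def using localized_ints_fraction[OF x_eq(2,3)] by blast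
  then show thesis
    by (rule that)
qed

lemma pochhammer_rat_cong:
  assumes "x \<in> localized_ints p" "y \<in> localized_ints p" "rat_cong x y p m"
  shows "rat_cong (pochhammer x k) (pochhammer y k) p m"
proof (induction k)
  case (Suc k)
  have "rat_cong ((x + of_nat k) * (pochhammer x k - pochhammer y k) + pochhammer y k * (x - y)) 0 p m"
    using assms Suc.IH rat_cong_iff_diff_rat_cong_0
    by (metis rat_cong_0_add rat_cong_0_mult_left localized_ints_add localized_ints_of_nat
        localized_ints_pochhammer)
  also have "(x + of_nat k) * (pochhammer x k - pochhammer y k) + pochhammer y k * (x - y)
      = pochhammer x (Suc k) - pochhammer y (Suc k)"
    by (simp add: pochhammer_Suc algebra_simps)
  finally show ?case
    by (simp only: flip: rat_cong_iff_diff_rat_cong_0)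
qed (simp add: rat_cong_iff_diff_rat_cong_0[of 1])

lemma pochhammer_divide_fact_localized_ints:
  assumes "prime p" "x \<in> localized_ints p"
  shows "pochhammer x k / fact k \<in> localized_ints p"
proof -
  obtain s q where fact_eq: "\<not> p dvd q" "fact k = q * p ^ s"
    using prime_power_canonical[OF assms(1), of "fact k"] by auto
  obtain y where "rat_cong x (of_int y) p s"
    using assms(2) by (rule rat_cong_of_int_exists)
  with assms(2) have "rat_cong (pochhammer x k) (of_int (pochhammer y k)) p s"
    unfolding pochhammer_of_int[symmetric] by (intro pochhammer_rat_cong) simp_all
  then obtain z where pochhammer_eq: "z \<in> localized_ints p"
    "pochhammer x k = of_int (pochhammer y k) + of_nat (p ^ s) * z"
    by (auto simp: rat_cong_def algebra_simps)
  obtain c where "pochhammer y k = fact k * c"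
    using fact_dvd_pochhammer[of k y] by (rule dvdE)
  moreover have "(fact k :: rat) = of_nat q * of_nat (p ^ s)"
    by (metis fact_eq(2) of_nat_fact of_nat_mult)
  moreover have "(fact k :: rat) \<noteq> 0"
    by simp
  ultimately have "pochhammer x k / fact k = of_int c + 1 / of_nat q * z"
    using pochhammer_eq(2) by (simp add: add_divide_distrib)
  then show ?thesis
    using localized_ints_one_divide_of_nat[OF assms(1) fact_eq(1)] pochhammer_eq(1)
    by (simp only: localized_ints_add localized_ints_mult localized_ints_of_int)
qed

section \<open>A Wolstenholme-type congruence\<close>

lemma prime_power_divide_rat_cong_0:
  assumes "prime p" "0 < m" "m < p ^ r"
  shows "rat_cong (of_nat (p ^ r) / of_nat m) 0 p 1"
proof -
  obtain s q where m_eq: "\<not> p dvd q" "m = q * p ^ s"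
    using prime_power_canonical[OF assms(1,2)] by auto
  then have "p ^ s < p ^ r"
    using assms(2,3) by (metis dvd_imp_le dvd_triv_right order.strict_trans1)
  then have "s < r"
    using power_less_imp_less_exp prime_gt_1_nat[OF assms(1)] by blast
  then obtain d where "r = s + 1 + d"
    using less_iff_Suc_add by auto
  then have "of_nat (p ^ r) / of_nat m = of_nat (p ^ 1) * (of_nat (p ^ d) * (1 / of_nat q) :: rat)"
    using prime_gt_0_nat[OF assms(1)] by (simp add: m_eq(2) power_add)
  moreover have "of_nat (p ^ d) * (1 / of_nat q) \<in> localized_ints p"
    using assms(1) m_eq(1)
    by (intro localized_ints_mult localized_ints_one_divide_of_nat localized_ints_of_nat)
  ultimately show ?thesis
    unfolding rat_cong_0_iff by blast
qed

lemma prime_power_divide_complement_square_rat_cong: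
  assumes "prime p" "0 < i" "i < p ^ r"
  shows "rat_cong ((of_nat (p ^ r) / of_nat (p ^ r - i))\<^sup>2) ((of_nat (p ^ r) / of_nat i)\<^sup>2) p 3"
proof -
  define u v :: rat where "u = of_nat (p ^ r) / of_nat (p ^ r - i)" and "v = of_nat (p ^ r) / of_nat i"
  have uv_cong: "rat_cong u 0 p 1" "rat_cong v 0 p 1"
    unfolding u_def v_def using assms by (intro prime_power_divide_rat_cong_0; simp)+
  have "(c + d) / c + (c + d) / d = (c + d) / c * ((c + d) / d)" if "c \<noteq> 0" "d \<noteq> 0" for c d :: rat
    using that by (simp add: field_simps)
  from this[of "of_nat (p ^ r - i)" "of_nat i"] have "u + v = u * v"
    using assms(2,3) by (simp add: u_def v_def flip: of_nat_add of_nat_power)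
  then have "u\<^sup>2 - v\<^sup>2 = u * v * (u - v)"
    by (simp add: power2_eq_square square_diff_square_factored)
  moreover have "rat_cong (u * v * (u - v)) 0 p 3"
    using rat_cong_0_mult[OF rat_cong_0_mult[OF uv_cong] rat_cong_0_diff[OF uv_cong]]
    by (simp add: numeral_3_eq_3)
  ultimately show ?thesis
    by (simp add: rat_cong_iff_diff_rat_cong_0[of "_\<^sup>2"] del: of_nat_power flip: u_def v_def)
qed

text \<open>Doubling modulo \<open>n = p\<^sup>r\<close>, up to sign, permutes \<open>{1..N}\<close>; therefore the sum \<open>T\<close> satisfies
  \<open>T \<equiv> T / 4\<close> modulo \<open>p\<^sup>3\<close>.\<close>

lemma sum_prime_power_divide_square_rat_cong_0:
  assumes "prime p" "p > 3" and p_power: "p ^ r = 2 * N + 1"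
  shows "rat_cong (\<Sum>i = 1..N. (of_nat (p ^ r) / of_nat i)\<^sup>2) 0 p 3"
proof -
  define f :: "nat \<Rightarrow> rat" where "f = (\<lambda>i. (of_nat (p ^ r) / of_nat i)\<^sup>2)"
  define s where "s = (\<lambda>j. if 2 * j \<le> N then 2 * j else p ^ r - 2 * j)"
  have "s ` {1..N} \<subseteq> {1..N}"
    using p_power by (auto simp: s_def)
  moreover have "inj_on s {1..N}"
    unfolding s_def inj_on_def using p_power by (auto split: if_splits) presburger+
  ultimately have bij_s: "bij_betw s {1..N} {1..N}"
    by (simp add: bij_betw_def endo_inj_surj)
  have f_double: "f (2 * j) = f j / 4" for j
    by (simp add: f_def power2_eq_square)
  have "rat_cong (f (s j) - f j / 4) 0 p 3" if "j \<in> {1..N}" for j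
  proof (cases "2 * j \<le> N")
    case False
    have "rat_cong (f (p ^ r - 2 * j)) (f (2 * j)) p 3"
      unfolding f_def using that p_power
      by (intro prime_power_divide_complement_square_rat_cong assms(1)) auto
    with False show ?thesis
      by (simp add: s_def f_double rat_cong_iff_diff_rat_cong_0[of "f _"])
  qed (simp add: s_def f_double)
  then have "rat_cong (\<Sum>j = 1..N. f (s j) - f j / 4) 0 p 3"
    by (rule rat_cong_0_sum)
  moreover have "4 * (1 / 3) \<in> localized_ints p"
    using localized_ints_mult[OF localized_ints_of_nat[of 4] localized_ints_one_divide_numeral] assms(1,2)
    by simp
  ultimately have "rat_cong (4 * (1 / 3) * (\<Sum>j = 1..N. f (s j) - f j / 4)) 0 p 3"
    by (rule rat_cong_0_mult_left[rotated])
  also have "(\<Sum>j = 1..N. f (s j) - f j / 4) = (\<Sum>j = 1..N. f j) - (\<Sum>j = 1..N. f j) / 4"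
    using sum.reindex_bij_betw[OF bij_s, of f] by (simp add: sum_subtractf sum_divide_distrib)
  finally show ?thesis
    by (simp add: f_def)
qed

section \<open>The congruence for the truncated sum\<close>

lemma prime_power_half_square_rat_cong_0:
  assumes "prime p" "0 < i" "2 * i < p ^ r"
  shows "rat_cong ((of_nat (p ^ r) / 2 / of_nat i)\<^sup>2) 0 p 2"
proof -
  have "rat_cong (of_nat (p ^ r) / of_nat (2 * i)) 0 p 1"
    using assms by (intro prime_power_divide_rat_cong_0) simp_all
  from rat_cong_0_mult[OF this this] show ?thesis
    by (simp add: power2_eq_square numeral_2_eq_2)
qed

lemma sine_prod_half_rat_cong_1:
  assumes "prime p" "2 * j < p ^ r"
  shows "rat_cong (sine_prod (of_nat (p ^ r) / 2) j) 1 p 2"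
  unfolding sine_prod_def using assms
  by (intro prod_one_minus_rat_cong_1 prime_power_half_square_rat_cong_0) auto

lemma full_sine_prod_half_rat_cong_1:
  assumes "prime p" "p > 3" and p_power: "p ^ r = 2 * N + 1"
  shows "rat_cong (sine_prod (of_nat (p ^ r) / 2) N) 1 p 3"
proof -
  define f :: "nat \<Rightarrow> rat" where "f = (\<lambda>i. (of_nat (p ^ r) / 2 / of_nat i)\<^sup>2)"
  have "rat_cong (f i) 0 p 2" if "i \<in> {1..N}" for i
    unfolding f_def using that p_power by (intro prime_power_half_square_rat_cong_0 assms(1)) auto
  then have "rat_cong (\<Prod>i = 1..N. 1 - f i) (1 - (\<Sum>i = 1..N. f i)) p (2 * 2)"
    by (rule prod_one_minus_rat_cong_one_minus_sum)
  then have "rat_cong ((\<Prod>i = 1..N. 1 - f i) - (1 - (\<Sum>i = 1..N. f i))) 0 p 3"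
    unfolding rat_cong_iff_diff_rat_cong_0[of "prod _ _"] by (rule rat_cong_0_mono) simp
  moreover have "rat_cong (\<Sum>i = 1..N. f i) 0 p 3"
  proof -
    have "1 / 2 \<in> localized_ints p"
      using localized_ints_one_divide_numeral[OF assms(1)] assms(2) by simp
    then have "1 / 2 * (1 / 2) \<in> localized_ints p"
      using localized_ints_mult by blast
    from rat_cong_0_mult_left[OF this sum_prime_power_divide_square_rat_cong_0[OF assms]] show ?thesis
      by (simp add: f_def power_divide sum_distrib_left)
  qed
  ultimately have "rat_cong ((\<Prod>i = 1..N. 1 - f i) - 1) 0 p 3"
    using rat_cong_0_diff by fastforce
  then show ?thesis
    by (simp add: rat_cong_iff_diff_rat_cong_0[of "prod _ _"] sine_prod_def f_def)
qed

lemma prime_power_divide_times_one_minus_rat_cong_0: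
  assumes "prime p" "p > 3" and p_power: "p ^ r = 2 * N + 1" and "j \<le> N"
  shows "rat_cong (of_nat (p ^ r) / (2 * of_nat j + 1)
      * (1 - 1 / sine_prod (of_nat (p ^ r) / 2) j)) 0 p 3"
proof -
  define m :: rat where "m = of_nat (p ^ r) / of_nat (2 * j + 1)"
  define P :: rat where "P = sine_prod (of_nat (p ^ r) / 2) j"
  have P_cong: "rat_cong P 1 p 2"
    unfolding P_def using assms(4) p_power
    by (intro sine_prod_half_rat_cong_1 assms(1)) simp
  have "p \<noteq> 1"
    using assms(2) by simp
  with P_cong have P_unit: "P \<noteq> 0" "1 / P \<in> localized_ints p"
    using rat_cong_1_imp_one_divide_localized_ints[of p P 1] by (simp_all add: numeral_2_eq_2)
  have "rat_cong (m * (P - 1)) 0 p 3"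
  proof (cases "j = N")
    case True
    then have "m = 1"
      using p_power by (simp add: m_def)
    with True show ?thesis
      using full_sine_prod_half_rat_cong_1[OF assms(1-3)]
      by (simp add: P_def flip: rat_cong_iff_diff_rat_cong_0)
  next
    case False
    with assms(4) have "rat_cong m 0 p 1"
      unfolding m_def using p_power by (intro prime_power_divide_rat_cong_0 assms(1)) auto
    with P_cong show ?thesis
      using rat_cong_0_mult[of m p 1 "P - 1" 2]
      by (simp add: numeral_3_eq_3 flip: rat_cong_iff_diff_rat_cong_0)
  qed
  with P_unit(2) have "rat_cong (1 / P * (m * (P - 1))) 0 p 3"
    by (rule rat_cong_0_mult_left)
  also have "1 / P * (m * (P - 1)) = m * (1 - 1 / P)"
    using P_unit(1) by (simp add: field_simps)
  finally show ?thesis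
    by (simp add: m_def P_def add.commute)
qed

theorem sum_half_ratio_power4_rat_cong:
  assumes "prime p" "p > 3" and p_power: "p ^ r = 2 * N + 1"
  shows "rat_cong (\<Sum>k\<le>N. (4 * of_nat k + 1) * half_ratio k ^ 4) (of_nat (p ^ r)) p (r + 3)"
proof -
  define e :: "nat \<Rightarrow> rat" where
    "e = (\<lambda>j. of_int ((-1) ^ j * int (N choose j)) * half_ratio j
        * (pochhammer (1 + of_nat (p ^ r) / 2) j / fact j))"
  define d :: "nat \<Rightarrow> rat" where
    "d = (\<lambda>j. of_nat (p ^ r) / (2 * of_nat j + 1)
        * (1 - 1 / sine_prod (of_nat (p ^ r) / 2) j))"
  have half_localized: "1 / 2 \<in> localized_ints p"
    using localized_ints_one_divide_numeral[OF assms(1)] assms(2) by simp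
  then have half_ratio_localized: "half_ratio k \<in> localized_ints p" for k
    unfolding half_ratio_def by (rule pochhammer_divide_fact_localized_ints[OF assms(1)])
  have "1 + of_nat (p ^ r) / 2 \<in> localized_ints p"
    using localized_ints_add[OF localized_ints_1 localized_ints_mult[OF localized_ints_of_nat half_localized]]
    by (simp del: of_nat_power)
  then have "e j \<in> localized_ints p" for j
    unfolding e_def using half_ratio_localized
    by (intro localized_ints_mult pochhammer_divide_fact_localized_ints assms(1) localized_ints_of_int)
  moreover have "rat_cong (d j) 0 p 3" if "j \<le> N" for j
    unfolding d_def using that by (rule prime_power_divide_times_one_minus_rat_cong_0[OF assms])
  ultimately have "rat_cong ((half_ratio N * half_ratio N) * (\<Sum>j\<le>N. e j * d j)) 0 p 3"
    using half_ratio_localized by (intro rat_cong_0_mult_left rat_cong_0_sum localized_ints_mult) auto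
  moreover have "rat_cong (of_nat (p ^ r)) 0 p r"
    unfolding rat_cong_0_iff by (rule bexI[of _ 1]) simp_all
  ultimately have "rat_cong (of_nat (p ^ r) * ((half_ratio N * half_ratio N) * (\<Sum>j\<le>N. e j * d j))) 0
      p (r + 3)"
    by (intro rat_cong_0_mult)
  moreover have "2 * of_nat N + 1 = (of_nat (p ^ r) :: rat)"
    by (simp add: p_power)
  ultimately show ?thesis
    using sum_half_ratio_power4_minus[of N, where 'a = rat]
    by (simp add: rat_cong_iff_diff_rat_cong_0[of "sum _ _"] e_def d_def power2_eq_square mult.assoc
        del: of_nat_power)
qed

theorem theorem1:
  fixes p r :: nat
  assumes "prime p" and "p > 3" and "r > 0"
  shows "rat_cong
           (\<Sum>k = 0..(p ^ r - 1) div 2.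
              (4 * of_nat k + 1) * (pochhammer (1 / 2) k / fact k) ^ 4)
           (of_nat (p ^ r)) p (3 + r)"
proof -
  have "odd (p ^ r)"
    using assms prime_odd_nat[of p] by simp
  then have "p ^ r = 2 * ((p ^ r - 1) div 2) + 1"
    by simp
  from sum_half_ratio_power4_rat_cong[OF assms(1,2) this] show ?thesis
    by (simp add: half_ratio_def atLeast0AtMost add.commute)
qed

end
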